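(* Let $d\ge 1$, let $\underline u<\overline u$ and $L>0$ be real numbers, and let $\psi=\psi(u,s)$ be a real function such that: (i) $\psi\in C^2([\underline u,\overline u]\times[0,L])$; (ii) $\psi\ge 0$ and $\psi+2sD_s\psi\ge 0$ on $[\underline u,\overline u]\times[0,L]$; (iii) $\displaystyle\frac{d-1}{4}(D_u\psi)^2\le-\psi\,D^2_{uu}\psi$ on $[\underline u,\overline u]\times[0,L]$. Let $u\in C^3(\overline Q)$ be a solution of $$u_t=\operatorname{div}\bigl(\psi(u,|Du|^2)Du\bigr)\quad\text{in }Q,\qquad u(x,0)=u_0(x)\quad\text{for }x\in\mathbb{T}^d,$$ such that for all $t\ge 0$ $$\underline u\le u(\cdot,t)\le\overline u\quad\text{and}\quad\|Du(\cdot,t)\|_{L^\infty(\mathbb{T}^d)}\le\sqrt L.$$ Then for all $t\ge 0$ $$\min_{\mathbb{T}^d}u_0\le u(\cdot,t)\le\max_{\mathbb{T}^d}u_0\quad\text{and}\quad\|Du(\cdot,t)\|_{L^\infty(\mathbb{T}^d)}\le\|Du_0\|_{L^\infty(\mathbb{T}^d)}.$$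
   Context: $\mathbb{T}^d=(\mathbb{R}/\mathbb{Z})^d$ is the $d$-dimensional torus, $Q:=\mathbb{T}^d\times(0,+\infty)$ and $\overline Q=\mathbb{T}^d\times[0,+\infty)$. $Du$ is the gradient of $u$ in the space variable $x$ and $\operatorname{div}$ is the divergence in $x$. $D_u\psi$, $D_s\psi$, $D^2_{uu}\psi$ denote the partial derivatives of $\psi$ with respect to its first and second arguments. $\|Du(\cdot,t)\|_{L^\infty(\mathbb{T}^d)}$ is the supremum over $x\in\mathbb{T}^d$ of the Euclidean norm $|Du(x,t)|$. *)

theory Defs
  imports "HOL-Analysis.Analysis"
begin

(* Partial derivative of f at x in direction b, relative to the domain S (one-sided at
   boundary points).  It is only used for sets S that are convex with nonempty interior, where
   the derivative within S is unique at every point of S. *)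
definition partial_on :: "'a::euclidean_space set \<Rightarrow> 'a \<Rightarrow> ('a \<Rightarrow> real) \<Rightarrow> 'a \<Rightarrow> real"
  where "partial_on S b f x = frechet_derivative f (at x within S) b"

(* C^k on S, up to and including the boundary points that belong to S. *)
primrec C_on :: "nat \<Rightarrow> 'a::euclidean_space set \<Rightarrow> ('a \<Rightarrow> real) \<Rightarrow> bool"
  where
    "C_on 0 S f \<longleftrightarrow> continuous_on S f"
  | "C_on (Suc k) S f \<longleftrightarrow> f differentiable_on S \<and> (\<forall>b\<in>Basis. C_on k S (partial_on S b f))"

definition grad :: "(real^'d \<Rightarrow> real) \<Rightarrow> real^'d \<Rightarrow> real^'d"
  where "grad f x = (\<chi> i. partial_on UNIV (axis i 1) f x)"

definition divergence :: "(real^'d \<Rightarrow> real^'d) \<Rightarrow> real^'d \<Rightarrow> real"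
  where "divergence F x = (\<Sum>i\<in>UNIV. partial_on UNIV (axis i 1) (\<lambda>y. F y $ i) x)"

(* Functions on the torus (R/Z)^d are represented by the Z^d-periodic functions on R^d;
   it suffices to require period 1 in every coordinate direction. *)
definition torus_periodic :: "(real^'d \<Rightarrow> real) \<Rightarrow> bool"
  where "torus_periodic f \<longleftrightarrow> (\<forall>x i. f (x + axis i 1) = f x)"

(* The supremum norm.  The supremum is meaningful for bounded fields; here it is applied to
   continuous periodic ones. *)
definition sup_norm :: "(real^'d \<Rightarrow> real^'d) \<Rightarrow> real"
  where "sup_norm F = (SUP x. norm (F x))"

end

(* Both bounds are parabolic maximum principles.  At a spatial extremum of u the equation reads
   u_t = psi * Laplace(u), which has the right sign.  For w = |Du|^2, let p = Du and M = D^2 u at a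
   spatial maximum of w.  There Dw = 0, that is, M p = 0, and applying 2 p . D to the equation gives
     w_t = (psi tr(D^2 w) + 2 psi_s p . D^2 w p) + 2 (psi_uu w^2 + psi_u w tr M - psi |M|^2).
   The first bracket is nonpositive by ellipticity (psi >= 0 and psi + 2 s psi_s >= 0) and D^2 w <= 0.
   Since M p = 0 gives (tr M)^2 <= (d - 1) |M|^2, the second one is bounded by a quadratic form in
   (w, tr M) which hypothesis (iii) makes nonpositive, once it is known that psi_uu <= 0. *)
theory Submission
  imports Defs
begin

section \<open>Partial derivatives\<close>

text \<open>Hypothesis (iii) is a discriminant condition. Since |M|^2 >= (tr M)^2 / (d - 1), the
  second bracket is at most half-free of M: it is bounded by a quadratic form in (w, tr M) whose
  discriminant is nonpositive exactly under (iii), and d - 1 counts the directions left once M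
  annihilates p. For d = 1 this division is impossible, but then tr M = 0 if p is nonzero. At zeros
  of \<open>\<psi>\<close>, (iii) says nothing about the sign of psi_uu; it is recovered from
  continuity along an interval of values of u. Regularity shapes the rest. The sign of w_t comes
  from w_t = 2 p . D u_t, that is, from commuting time and space derivatives; this is done only for
  t > 0, where derivatives relative to the closed half space are two-sided. The pair (u, |Du|^2) may
  touch the boundary of the rectangle on which \<open>\<psi>\<close> lives, so \<open>\<psi>\<close>
  is differentiated relative to that rectangle and the chain rule is stated for maps into
  it.\<close>

lemma C_on_imp_continuous_on: "C_on k S f \<Longrightarrow> continuous_on S f"
  by (cases k) (auto simp: differentiable_imp_continuous_on)

text \<open>The inner map only has to take values in S, possibly on its boundary. This covers both
  \<open>\<psi>\<close> evaluated at extreme values of its arguments and the slice of the half space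
  at time 0.\<close>

lemma C_on_compose_has_derivative:
  assumes "C_on (Suc k) S f" "(g has_derivative g') (at x within T)" "g ` T \<subseteq> S" "x \<in> T"
  shows "((\<lambda>y. f (g y)) has_derivative
    (\<lambda>h. frechet_derivative f (at (g x) within S) (g' h))) (at x within T)"
proof -
  have "\<And>z. z \<in> S \<Longrightarrow> (f has_derivative frechet_derivative f (at z within S)) (at z within S)"
    using assms(1) by (auto simp: differentiable_on_def frechet_derivative_works)
  from has_derivative_in_compose2[OF this assms(3,4,2)] show ?thesis by simp
qed

lemma C_on_linear_frechet_derivative:
  assumes "C_on (Suc k) S f" "x \<in> S"
  shows "linear (frechet_derivative f (at x within S))"
  using assms by (auto simp: differentiable_on_def intro: linear_frechet_derivative)

lemma C_on_partial_on:
  assumes "C_on (Suc k) S f" "b \<in> Basis"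
  shows "C_on k S (partial_on S b f)"
  using assms by simp

text \<open>At interior points the derivative relative to S is an ordinary one, so it restricts to
  two-sided derivatives along lines, the form used for interchanging partial derivatives.\<close>

lemma C_on_has_line_derivative:
  assumes "C_on (Suc k) S f" "open U" "U \<subseteq> S" "x \<in> U"
  shows "((\<lambda>\<tau>. f (x + \<tau> *\<^sub>R b)) has_real_derivative partial_on S b f x) (at 0)"
proof -
  have "x \<in> interior S" using assms interior_maximal by blast
  then have at: "at x within S = at x" by (rule at_within_interior)
  have "(f has_derivative frechet_derivative f (at x within S)) (at x within S)"
    using assms by (auto simp: differentiable_on_def frechet_derivative_works)
  then have D: "(f has_derivative frechet_derivative f (at x within S)) (at x)"
    unfolding at .
  have g: "((\<lambda>\<tau>. x + \<tau> *\<^sub>R b) has_derivative (\<lambda>h. h *\<^sub>R b)) (at 0)"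
    by (auto intro!: derivative_eq_intros)
  have "((\<lambda>\<tau>. f (x + \<tau> *\<^sub>R b)) has_derivative
      (\<lambda>h. frechet_derivative f (at x within S) (h *\<^sub>R b))) (at 0)"
    using has_derivative_compose[OF g, of f "frechet_derivative f (at x within S)"] D by simp
  moreover have "(\<lambda>h. frechet_derivative f (at x within S) (h *\<^sub>R b)) = (*) (partial_on S b f x)"
    using linear_cmul[OF has_derivative_linear[OF D]] by (auto simp: partial_on_def fun_eq_iff mult.commute)
  ultimately show ?thesis by (simp add: has_field_derivative_def)
qed

text \<open>Two applications of the mean value theorem: to the increment of f under the shift
  \<open>s *\<^sub>R c\<close>, as a function of the position along b, and then to \<open>fb\<close>
  along c. The bound on s keeps the whole parallelogram in the ball.\<close>

lemma second_difference:
  fixes f :: "'a::real_normed_vector \<Rightarrow> real"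
  assumes "ball z r \<subseteq> U" "s > 0" "s * (norm b + norm c) < r"
    and fb: "\<And>x. x \<in> U \<Longrightarrow> ((\<lambda>\<tau>. f (x + \<tau> *\<^sub>R b)) has_real_derivative fb x) (at 0)"
    and fbc: "\<And>x. x \<in> U \<Longrightarrow> ((\<lambda>\<tau>. fb (x + \<tau> *\<^sub>R c)) has_real_derivative fbc x) (at 0)"
  obtains x where "dist z x < r"
    "f (z + s *\<^sub>R b + s *\<^sub>R c) - f (z + s *\<^sub>R b) - f (z + s *\<^sub>R c) + f z = s * s * fbc x"
proof -
  have shift: "((\<lambda>\<tau>. g (x + \<tau> *\<^sub>R d)) has_real_derivative g' (x + \<tau>0 *\<^sub>R d)) (at \<tau>0)"
    if "((\<lambda>\<tau>. g ((x + \<tau>0 *\<^sub>R d) + \<tau> *\<^sub>R d)) has_real_derivative g' (x + \<tau>0 *\<^sub>R d)) (at 0)"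
    for g g' :: "'a \<Rightarrow> real" and x d \<tau>0
  proof -
    have "(\<lambda>\<tau>. g ((x + \<tau>0 *\<^sub>R d) + \<tau> *\<^sub>R d)) = (\<lambda>\<tau>. g (x + (\<tau> + \<tau>0) *\<^sub>R d))"
      by (simp only: scaleR_add_left add.assoc add.commute[of "_ *\<^sub>R d" "\<tau>0 *\<^sub>R d"])
    then show ?thesis
      using DERIV_shift[of "\<lambda>\<tau>. g (x + \<tau> *\<^sub>R d)" "g' (x + \<tau>0 *\<^sub>R d)" 0 \<tau>0] that by simp
  qed
  have near: "dist z (z + \<alpha> *\<^sub>R b + \<beta> *\<^sub>R c) < r" if "0 \<le> \<alpha>" "\<alpha> \<le> s" "0 \<le> \<beta>" "\<beta> \<le> s" for \<alpha> \<beta>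
  proof -
    have "norm (\<alpha> *\<^sub>R b + \<beta> *\<^sub>R c) \<le> \<alpha> * norm b + \<beta> * norm c"
      using norm_triangle_ineq[of "\<alpha> *\<^sub>R b" "\<beta> *\<^sub>R c"] that by simp
    also have "\<dots> \<le> s * norm b + s * norm c"
      using that by (intro add_mono mult_right_mono) auto
    also have "\<dots> < r" using assms by (simp add: algebra_simps)
    finally have "norm (\<alpha> *\<^sub>R b + \<beta> *\<^sub>R c) < r" .
    moreover have "dist z (z + \<alpha> *\<^sub>R b + \<beta> *\<^sub>R c) = norm (\<alpha> *\<^sub>R b + \<beta> *\<^sub>R c)"
      by (metis add.assoc add_diff_cancel_left' dist_commute dist_norm)
    ultimately show ?thesis by simp
  qed
  then have nearU: "z + \<alpha> *\<^sub>R b + \<beta> *\<^sub>R c \<in> U" if "0 \<le> \<alpha>" "\<alpha> \<le> s" "0 \<le> \<beta>" "\<beta> \<le> s" for \<alpha> \<beta>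
    using that assms(1) by auto
  have "((\<lambda>\<alpha>. f ((z + s *\<^sub>R c) + \<alpha> *\<^sub>R b) - f (z + \<alpha> *\<^sub>R b)) has_real_derivative
      fb ((z + s *\<^sub>R c) + \<alpha> *\<^sub>R b) - fb (z + \<alpha> *\<^sub>R b)) (at \<alpha>)" if "0 \<le> \<alpha>" "\<alpha> \<le> s" for \<alpha>
    using nearU[OF that, of s] nearU[OF that, of 0] assms(2)
    by (intro DERIV_diff shift[where g = f and g' = fb, OF fb]) (auto simp: add_ac)
  from MVT2[OF assms(2) this] obtain \<xi> where \<xi>: "0 < \<xi>" "\<xi> < s"
    "(f ((z + s *\<^sub>R c) + s *\<^sub>R b) - f (z + s *\<^sub>R b)) - (f ((z + s *\<^sub>R c) + 0 *\<^sub>R b) - f (z + 0 *\<^sub>R b))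
      = (s - 0) * (fb ((z + s *\<^sub>R c) + \<xi> *\<^sub>R b) - fb (z + \<xi> *\<^sub>R b))"
    by blast
  have "((\<lambda>\<beta>. fb ((z + \<xi> *\<^sub>R b) + \<beta> *\<^sub>R c)) has_real_derivative fbc ((z + \<xi> *\<^sub>R b) + \<beta> *\<^sub>R c)) (at \<beta>)"
    if "0 \<le> \<beta>" "\<beta> \<le> s" for \<beta>
    using nearU[of \<xi> \<beta>] \<xi> that by (intro shift[where g = fb and g' = fbc, OF fbc]) auto
  from MVT2[OF assms(2) this] obtain \<eta> where \<eta>: "0 < \<eta>" "\<eta> < s"
    "fb ((z + \<xi> *\<^sub>R b) + s *\<^sub>R c) - fb ((z + \<xi> *\<^sub>R b) + 0 *\<^sub>R c)
      = (s - 0) * fbc ((z + \<xi> *\<^sub>R b) + \<eta> *\<^sub>R c)"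
    by blast
  have "f (z + s *\<^sub>R b + s *\<^sub>R c) - f (z + s *\<^sub>R b) - f (z + s *\<^sub>R c) + f z
      = s * (fb ((z + \<xi> *\<^sub>R b) + s *\<^sub>R c) - fb (z + \<xi> *\<^sub>R b))"
    using \<xi>(3) by (simp add: algebra_simps)
  also have "\<dots> = s * s * fbc (z + \<xi> *\<^sub>R b + \<eta> *\<^sub>R c)" using \<eta>(3) by simp
  finally show ?thesis using that near[of \<xi> \<eta>] \<xi> \<eta> by auto
qed

text \<open>Schwarz's theorem: the second difference is symmetric in b and c, so \<open>fbc\<close>
  and \<open>fcb\<close> take a common value at two points arbitrarily close to z, and continuity at
  z does the rest.\<close>

lemma mixed_derivatives_commute:
  fixes f :: "'a::real_normed_vector \<Rightarrow> real"
  assumes "open U" "z \<in> U"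
    and fb: "\<And>x. x \<in> U \<Longrightarrow> ((\<lambda>\<tau>. f (x + \<tau> *\<^sub>R b)) has_real_derivative fb x) (at 0)"
    and fc: "\<And>x. x \<in> U \<Longrightarrow> ((\<lambda>\<tau>. f (x + \<tau> *\<^sub>R c)) has_real_derivative fc x) (at 0)"
    and fbc: "\<And>x. x \<in> U \<Longrightarrow> ((\<lambda>\<tau>. fb (x + \<tau> *\<^sub>R c)) has_real_derivative fbc x) (at 0)"
    and fcb: "\<And>x. x \<in> U \<Longrightarrow> ((\<lambda>\<tau>. fc (x + \<tau> *\<^sub>R b)) has_real_derivative fcb x) (at 0)"
    and cont: "isCont fbc z" "isCont fcb z"
  shows "fbc z = fcb z"
proof (rule ccontr)
  assume "fbc z \<noteq> fcb z"
  define e where "e = \<bar>fbc z - fcb z\<bar> / 2"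
  have "e > 0" using \<open>fbc z \<noteq> fcb z\<close> by (simp add: e_def)
  obtain r1 where r1: "r1 > 0" "\<And>x. dist x z < r1 \<Longrightarrow> dist (fbc x) (fbc z) < e"
    using cont(1) \<open>e > 0\<close> unfolding continuous_at_eps_delta by metis
  obtain r2 where r2: "r2 > 0" "\<And>x. dist x z < r2 \<Longrightarrow> dist (fcb x) (fcb z) < e"
    using cont(2) \<open>e > 0\<close> unfolding continuous_at_eps_delta by metis
  obtain r3 where r3: "r3 > 0" "ball z r3 \<subseteq> U" using assms(1,2) openE by blast
  define r where "r = min r1 (min r2 r3)"
  have r: "r > 0" "ball z r \<subseteq> U" using r1 r2 r3 by (auto simp: r_def)
  \<comment> \<open>The summand 1 keeps the denominator positive when b and c are both zero.\<close>
  define s where "s = r / (2 * (norm b + norm c + 1))"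
  have pos: "norm b + norm c + 1 > 0" by (simp add: add_nonneg_pos)
  then have s: "s > 0" using r by (simp add: s_def)
  have "s * (norm b + norm c + 1) = r / 2" using pos by (simp add: s_def field_simps)
  then have sr: "s * (norm b + norm c) < r" "s * (norm c + norm b) < r"
    using s r by (auto simp: algebra_simps)
  obtain x where x: "dist z x < r"
    "f (z + s *\<^sub>R b + s *\<^sub>R c) - f (z + s *\<^sub>R b) - f (z + s *\<^sub>R c) + f z = s * s * fbc x"
    using second_difference[OF r(2) s sr(1) fb fbc] by blast
  obtain y where y: "dist z y < r"
    "f (z + s *\<^sub>R c + s *\<^sub>R b) - f (z + s *\<^sub>R c) - f (z + s *\<^sub>R b) + f z = s * s * fcb y"
    using second_difference[OF r(2) s sr(2) fc fcb] by blast
  have "s * s * fbc x = s * s * fcb y" using x(2) y(2) by (simp add: algebra_simps)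
  then have "fbc x = fcb y" using s by simp
  moreover have "dist (fbc x) (fbc z) < e" "dist (fcb y) (fcb z) < e"
    using r1(2)[of x] r2(2)[of y] x y by (auto simp: r_def dist_commute)
  ultimately show False by (auto simp: e_def dist_real_def abs_real_def split: if_splits)
qed

lemma partial_on_commute:
  assumes f: "C_on (Suc (Suc k)) S f" and "open U" "U \<subseteq> S" "z \<in> U" and b: "b \<in> Basis" and c: "c \<in> Basis"
  shows "partial_on S b (partial_on S c f) z = partial_on S c (partial_on S b f) z"
proof -
  note line = C_on_has_line_derivative[OF _ \<open>open U\<close> \<open>U \<subseteq> S\<close>]
  have C1: "C_on (Suc k) S (partial_on S b f)" "C_on (Suc k) S (partial_on S c f)"
    using C_on_partial_on[OF f] b c by auto
  have "continuous_on S (partial_on S c (partial_on S b f))" "continuous_on S (partial_on S b (partial_on S c f))"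
    using C_on_partial_on[OF C1(1) c] C_on_partial_on[OF C1(2) b] C_on_imp_continuous_on by auto
  then have "isCont (partial_on S c (partial_on S b f)) z" "isCont (partial_on S b (partial_on S c f)) z"
    using assms by (meson continuous_on_eq_continuous_at continuous_on_subset)+
  from mixed_derivatives_commute[OF \<open>open U\<close> \<open>z \<in> U\<close> line[OF f] line[OF f] line[OF C1(1)] line[OF C1(2)] this]
  show ?thesis by simp
qed

section \<open>Linear algebra at the maximum point\<close>

lemma sum_axis_mult [simp]: "(\<Sum>k\<in>UNIV. axis i (1::real) $ k * a k) = a i"
  by (simp add: axis_def if_distrib[of "\<lambda>x. x * _"] cong: if_cong)

lemma trace_le_of_negative_semidefinite:
  fixes H :: "real^'n^'n" and e :: "real^'n"
  assumes neg: "\<And>h. h \<bullet> (H *v h) \<le> 0"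
  shows "(e \<bullet> e) * trace H \<le> e \<bullet> (H *v e)"
proof -
  define n where "n = e \<bullet> e"
  (* a i / n is the projection of the i-th unit vector onto the orthogonal complement of e; the
     values of the form H on these vectors add up to n^2 tr H - n e . H e. *)
  define a where "a i = n *\<^sub>R axis i 1 - (e $ i) *\<^sub>R e" for i
  have expand: "a i \<bullet> (H *v a i) = n * n * H $ i $ i - n * (e $ i * (H *v e) $ i)
      - n * (e $ i * (e v* H) $ i) + e $ i * e $ i * (e \<bullet> (H *v e))" for i
  proof -
    have 1: "axis i 1 \<bullet> (H *v axis i 1) = H $ i $ i"
      by (simp add: inner_axis' matrix_vector_mult_basis column_def)
    have 2: "e \<bullet> (H *v axis i 1) = (e v* H) $ i"
      by (simp add: dot_lmul_matrix[symmetric] inner_axis)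
    have 3: "axis i 1 \<bullet> (H *v e) = (H *v e) $ i" by (simp add: inner_axis')
    show ?thesis
      unfolding a_def matrix_vector_mult_diff_distrib matrix_vector_mult_scaleR
        inner_diff_left inner_diff_right inner_scaleR_left inner_scaleR_right 1 2 3
      by (simp add: algebra_simps)
  qed
  have s1: "(\<Sum>i\<in>UNIV. e $ i * (H *v e) $ i) = e \<bullet> (H *v e)" by (simp add: inner_vec_def)
  have s2: "(\<Sum>i\<in>UNIV. e $ i * (e v* H) $ i) = e \<bullet> (H *v e)"
    unfolding dot_lmul_matrix[symmetric] by (simp add: inner_vec_def mult.commute)
  have s3: "(\<Sum>i\<in>UNIV. e $ i * e $ i) = n" by (simp add: n_def inner_vec_def)
  have "(\<Sum>i\<in>UNIV. a i \<bullet> (H *v a i)) = n * n * trace H - n * (e \<bullet> (H *v e))"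
    unfolding expand sum.distrib sum_subtractf
    unfolding sum_distrib_left[symmetric] sum_distrib_right[symmetric] s1 s2 s3
    by (simp add: trace_def)
  moreover have "(\<Sum>i\<in>UNIV. a i \<bullet> (H *v a i)) \<le> 0" by (intro sum_nonpos neg)
  ultimately have "n * (n * trace H - e \<bullet> (H *v e)) \<le> 0" by (simp add: algebra_simps)
  moreover have "n \<ge> 0" by (simp add: n_def)
  ultimately show ?thesis
    using n_def by (cases "n = 0") (auto simp: mult_le_0_iff)
qed

lemma trace_nonpos_of_negative_semidefinite:
  fixes H :: "real^'n^'n"
  assumes neg: "\<And>h. h \<bullet> (H *v h) \<le> 0"
  shows "trace H \<le> 0"
proof -
  have "H $ i $ i \<le> 0" for i
    using neg[of "axis i 1"] by (simp add: inner_axis' matrix_vector_mult_basis column_def)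
  then show ?thesis by (auto simp: trace_def intro: sum_nonpos)
qed

text \<open>The left side is the trace of H against the matrix a I + 2 b e e^T, whose eigenvalues
  are a on the complement of e and a + 2 |e|^2 b along e. The two sign assumptions make this matrix
  nonnegative.\<close>

lemma elliptic_trace_nonpos:
  fixes H :: "real^'n^'n" and e :: "real^'n"
  assumes neg: "\<And>h. h \<bullet> (H *v h) \<le> 0" and "a \<ge> 0" "a + 2 * (e \<bullet> e) * b \<ge> 0"
  shows "a * trace H + 2 * b * (e \<bullet> (H *v e)) \<le> 0"
proof (cases "e = 0")
  case True
  then show ?thesis
    using trace_nonpos_of_negative_semidefinite[OF neg] \<open>a \<ge> 0\<close> by (simp add: mult_nonneg_nonpos)
next
  case False
  then have n: "e \<bullet> e > 0" by simp
  have "a * ((e \<bullet> e) * trace H) \<le> a * (e \<bullet> (H *v e))"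
    using trace_le_of_negative_semidefinite[OF neg] \<open>a \<ge> 0\<close> by (rule mult_left_mono)
  moreover have "(a + 2 * (e \<bullet> e) * b) * (e \<bullet> (H *v e)) \<le> 0"
    using assms(3) neg by (rule mult_nonneg_nonpos)
  ultimately have "(e \<bullet> e) * (a * trace H + 2 * b * (e \<bullet> (H *v e))) \<le> 0"
    by (simp add: algebra_simps)
  then show ?thesis using n by (simp add: mult_le_0_iff)
qed

lemma trace_square_le_of_kernel:
  fixes M :: "real^'n^'n" and e :: "real^'n"
  assumes "M *v e = 0" "e \<noteq> 0"
  shows "(trace M)\<^sup>2 \<le> (real CARD('n) - 1) * (M \<bullet> M)"
proof -
  define n where "n = e \<bullet> e"
  have n: "n > 0" using assms by (simp add: n_def)
  have nsum: "(\<Sum>i\<in>UNIV. e $ i * e $ i) = n" by (simp add: n_def inner_vec_def)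
  (* M e = 0 makes n tr M the inner product of M with n times the projection onto the complement
     of e, to which the Cauchy-Schwarz inequality applies. *)
  define P :: "real^'n^'n" where "P = (\<chi> i j. (if i = j then n else 0) - e $ i * e $ j)"
  have "M $ i \<bullet> P $ i = n * M $ i $ i - e $ i * (M *v e) $ i" for i
    by (simp add: inner_vec_def P_def right_diff_distrib sum_subtractf if_distrib[of "\<lambda>x. _ * x"]
      matrix_vector_mult_def sum_distrib_left mult_ac cong: if_cong)
  then have "M \<bullet> P = n * trace M"
    using assms(1) by (simp add: inner_vec_def[of M P] trace_def sum_distrib_left)
  moreover have "P $ i \<bullet> P $ i = n * n - n * (e $ i * e $ i)" for i
  proof -
    have "P $ i \<bullet> P $ i = (\<Sum>j\<in>UNIV. (if i = j then n * n - 2 * n * (e $ i * e $ i) else 0)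
        + e $ i * e $ i * (e $ j * e $ j))"
      unfolding inner_vec_def by (rule sum.cong) (auto simp: P_def algebra_simps)
    also have "\<dots> = n * n - n * (e $ i * e $ i)"
      by (simp add: sum.distrib sum_distrib_left[symmetric] nsum)
    finally show ?thesis .
  qed
  \<comment> \<open>The squared Frobenius norm of a projection is its rank, here d - 1; this is the
    source of the dimensional constant.\<close>
  then have "P \<bullet> P = n * n * (real CARD('n) - 1)"
    unfolding inner_vec_def[of P P]
    by (simp only: sum_subtractf sum_distrib_left[symmetric] nsum) (simp add: algebra_simps)
  ultimately have "(n * trace M)\<^sup>2 \<le> (M \<bullet> M) * (n * n * (real CARD('n) - 1))"
    using Cauchy_Schwarz_ineq[of M P] by simp
  then have "(n * n) * (trace M)\<^sup>2 \<le> (n * n) * ((real CARD('n) - 1) * (M \<bullet> M))"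
    by (simp add: power2_eq_square algebra_simps)
  then show ?thesis using n by (simp del: mult.assoc)
qed

text \<open>For m > 0, replacing N by its lower bound X^2 / m leaves a quadratic form in (W, X) with
  discriminant b^2 + 4 a c / m, which the second assumption makes nonpositive.\<close>

lemma quadratic_form_nonpos:
  fixes a b c m N W X :: real
  assumes "a \<ge> 0" "m / 4 * b\<^sup>2 \<le> - a * c" "c \<le> 0" "m \<ge> 0" "X\<^sup>2 \<le> m * N" "N \<ge> 0"
  shows "c * W\<^sup>2 + b * W * X - a * N \<le> 0"
proof (cases "m = 0")
  \<comment> \<open>For m = 0 the second assumption does not restrict b, but X = 0 removes the mixed
    term.\<close>
  case True
  then have "X = 0" using assms by simp
  moreover have "c * W\<^sup>2 \<le> 0" "a * N \<ge> 0" using assms by (auto intro: mult_nonpos_nonneg)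
  ultimately show ?thesis by simp
next
  case False
  then have m: "m > 0" using assms by simp
  show ?thesis
  proof (cases "a = 0")
    case True
    then have "b = 0" using assms(2) m by (simp add: mult_le_0_iff)
    then show ?thesis using True assms by (simp add: mult_nonpos_nonneg)
  next
    case False
    then have a: "a > 0" using assms by simp
    \<comment> \<open>Completing the square in X; the factor 4 a m clears all denominators.\<close>
    have "(4 * a * m) * (c * W\<^sup>2 + b * W * X - a * N)
        = 4 * m * W\<^sup>2 * (a * c + m / 4 * b\<^sup>2) - (m * b * W - 2 * a * X)\<^sup>2 + 4 * a\<^sup>2 * (X\<^sup>2 - m * N)"
      by (simp add: power2_eq_square algebra_simps)
    also have "\<dots> \<le> 0"
    proof -
      have "4 * m * W\<^sup>2 * (a * c + m / 4 * b\<^sup>2) \<le> 0" "4 * a\<^sup>2 * (X\<^sup>2 - m * N) \<le> 0"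
        using assms m by (auto intro!: mult_nonneg_nonpos)
      then show ?thesis using zero_le_power2[of "m * b * W - 2 * a * X"] by linarith
    qed
    finally show ?thesis using a m by (simp add: mult_le_0_iff zero_less_mult_iff)
  qed
qed

section \<open>Maximum principles\<close>

(* Where g2 > 0 the function g vanishes, and on an interval this forces g2 = 0. *)
lemma second_derivative_nonpos_of_product:
  fixes g :: "real \<Rightarrow> real"
  assumes "a < b"
    and g: "\<And>x. x \<in> {a..b} \<Longrightarrow> (g has_real_derivative g1 x) (at x within {a..b})"
    and g1: "\<And>x. x \<in> {a..b} \<Longrightarrow> (g1 has_real_derivative g2 x) (at x within {a..b})"
    and cont: "continuous_on {a..b} g2"
    and nonneg: "\<And>x. x \<in> {a..b} \<Longrightarrow> g x \<ge> 0" and prod: "\<And>x. x \<in> {a..b} \<Longrightarrow> g x * g2 x \<le> 0"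
    and x: "x \<in> {a..b}"
  shows "g2 x \<le> 0"
proof (rule ccontr)
  assume "\<not> g2 x \<le> 0"
  then obtain r where r: "r > 0" "\<And>y. y \<in> {a..b} \<Longrightarrow> dist y x < r \<Longrightarrow> dist (g2 y) (g2 x) < g2 x"
    using cont x unfolding continuous_on_iff by (metis not_le)
  have pos: "g2 y > 0" if "y \<in> {a..b}" "dist y x < r" for y
    using r(2)[OF that] by (simp add: dist_real_def abs_real_def split: if_splits)
  \<comment> \<open>The point x may be an endpoint of the interval, so the contradiction is sought
    at the midpoint of the open interval from l to h, where the derivatives are two-sided.\<close>
  define l where "l = max a (x - r)"
  define h where "h = min b (x + r)"
  have lh: "l < h" using r x \<open>a < b\<close> by (auto simp: l_def h_def)
  have I: "y \<in> {a..b} \<and> dist y x < r" if "y \<in> {l<..<h}" for y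
    using that by (auto simp: l_def h_def dist_real_def)
  have at: "at y within {a..b} = at y" if "y \<in> {l<..<h}" for y
    using that by (intro at_within_interior) (auto simp: l_def h_def)
  have g0: "g y = 0" if "y \<in> {l<..<h}" for y
    using pos[of y] prod[of y] nonneg[of y] I[OF that] by (auto simp: mult_le_0_iff)
  have g10: "g1 y = 0" if "y \<in> {l<..<h}" for y
  proof -
    have "(g has_real_derivative g1 y) (at y)" using g[of y] I[OF that] at[OF that] by simp
    then have "((\<lambda>_. 0) has_real_derivative g1 y) (at y)"
      by (rule has_field_derivative_transform_within_open[of _ _ _ "{l<..<h}"]) (use that g0 in auto)
    then show ?thesis using DERIV_unique DERIV_const by blast
  qed
  have mid: "(l + h) / 2 \<in> {l<..<h}" using lh by auto
  have "(g1 has_real_derivative g2 ((l+h)/2)) (at ((l+h)/2))" using g1 I[OF mid] at[OF mid] by metis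
  then have "((\<lambda>_. 0) has_real_derivative g2 ((l+h)/2)) (at ((l+h)/2))"
    by (rule has_field_derivative_transform_within_open[of _ _ _ "{l<..<h}"]) (use mid g10 in auto)
  then have "g2 ((l+h)/2) = 0" using DERIV_unique DERIV_const by blast
  then show False using pos[of "(l+h)/2"] I[OF mid] by simp
qed

text \<open>Restriction to the line through x0 in direction h: a positive second derivative at 0
  would make the first derivative positive just to the right, and the mean value theorem would lift
  w above its maximum.\<close>

lemma second_order_max:
  fixes w :: "real^'n \<Rightarrow> real"
  assumes w: "\<And>x. (w has_derivative (\<lambda>h. \<Sum>i\<in>UNIV. h $ i * w1 i x)) (at x)"
    and w1: "\<And>i. (w1 i has_derivative (\<lambda>h. \<Sum>k\<in>UNIV. h $ k * w2 k i)) (at x0)"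
    and max: "\<And>x. w x \<le> w x0"
  shows "w1 i x0 = 0" "h \<bullet> ((\<chi> k i. w2 k i) *v h) \<le> 0"
proof -
  have "(\<lambda>h. \<Sum>i\<in>UNIV. h $ i * w1 i x0) = (\<lambda>v. 0)"
    by (rule differential_zero_maxmin[OF _ open_UNIV w]) (use max in auto)
  from fun_cong[OF this, of "axis _ 1"] have crit: "w1 i x0 = 0" for i by simp
  show "w1 i x0 = 0" by (rule crit)
  define \<phi>1 where "\<phi>1 \<tau> = (\<Sum>i\<in>UNIV. h $ i * w1 i (x0 + \<tau> *\<^sub>R h))" for \<tau>
  have line: "((\<lambda>\<tau>. x0 + \<tau> *\<^sub>R h) has_derivative (\<lambda>s. s *\<^sub>R h)) (at \<tau>)" for \<tau>
    by (auto intro!: derivative_eq_intros)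
  have \<phi>: "((\<lambda>\<tau>. w (x0 + \<tau> *\<^sub>R h)) has_real_derivative \<phi>1 \<tau>) (at \<tau>)" for \<tau>
    unfolding has_field_derivative_def \<phi>1_def
    by (rule has_derivative_eq_rhs[OF has_derivative_compose[OF line[of \<tau>] w]])
       (simp add: fun_eq_iff sum_distrib_left sum_distrib_right mult_ac)
  have w1': "(w1 i has_derivative (\<lambda>h. \<Sum>k\<in>UNIV. h $ k * w2 k i)) (at (x0 + 0 *\<^sub>R h))" for i
    using w1 by simp
  have "((\<lambda>\<tau>. w1 i (x0 + \<tau> *\<^sub>R h)) has_real_derivative (\<Sum>k\<in>UNIV. h $ k * w2 k i)) (at 0)" for i
    unfolding has_field_derivative_def
    by (rule has_derivative_eq_rhs[OF has_derivative_compose[OF line[of 0] w1']])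
       (simp add: fun_eq_iff sum_distrib_left sum_distrib_right mult_ac)
  then have \<phi>1: "(\<phi>1 has_real_derivative (\<Sum>i\<in>UNIV. h $ i * (\<Sum>k\<in>UNIV. h $ k * w2 k i))) (at 0)"
    unfolding \<phi>1_def by (intro derivative_eq_intros) auto
  have eq: "h \<bullet> ((\<chi> k i. w2 k i) *v h) = (\<Sum>i\<in>UNIV. h $ i * (\<Sum>k\<in>UNIV. h $ k * w2 k i))"
    by (subst sum_distrib_left, subst sum.swap)
       (simp add: inner_vec_def matrix_vector_mult_def sum_distrib_left mult_ac)
  show "h \<bullet> ((\<chi> k i. w2 k i) *v h) \<le> 0"
  proof (rule ccontr)
    assume "\<not> ?thesis"
    then have "(\<Sum>i\<in>UNIV. h $ i * (\<Sum>k\<in>UNIV. h $ k * w2 k i)) > 0" using eq by simp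
    from DERIV_pos_inc_right[OF \<phi>1 this] obtain d where d: "d > 0"
      "\<And>s. s > 0 \<Longrightarrow> s < d \<Longrightarrow> \<phi>1 0 < \<phi>1 s" by auto
    have "\<phi>1 0 = 0" by (simp add: \<phi>1_def crit)
    obtain s where s: "0 < s" "s < d / 2"
      "w (x0 + (d/2) *\<^sub>R h) - w (x0 + 0 *\<^sub>R h) = (d / 2 - 0) * \<phi>1 s"
      using MVT2[of 0 "d / 2" "\<lambda>\<tau>. w (x0 + \<tau> *\<^sub>R h)" \<phi>1] \<phi> d(1) by auto
    have "\<phi>1 s > 0" using d s \<open>\<phi>1 0 = 0\<close> by fastforce
    then have "w (x0 + (d/2) *\<^sub>R h) > w x0"
      using s d(1) by (smt (verit) add.right_neutral mult_pos_pos half_gt_zero scaleR_zero_left)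
    then show False using max by (meson not_le)
  qed
qed

text \<open>Integer translations, applied one coordinate at a time, move any point into the unit
  cube; compactness of the cube then stands in for compactness of the torus.\<close>

lemma torus_periodic_frac:
  fixes f :: "real^'d \<Rightarrow> real"
  assumes "torus_periodic f"
  shows "f (\<chi> i. frac (x $ i)) = f x"
proof -
  have step: "f (x + axis i 1) = f x" for x i using assms by (simp add: torus_periodic_def)
  have nat: "f (x + real n *\<^sub>R axis i 1) = f x" for x n i
  proof (induction n)
    case (Suc n)
    then show ?case using step[of "x + real n *\<^sub>R axis i 1" i] by (simp add: algebra_simps)
  qed simp
  have int: "f (x + of_int k *\<^sub>R axis i 1) = f x" for x k i
  proof (cases "k \<ge> 0")
    case True
    then show ?thesis using nat[of x "nat k" i] by simp
  next
    case False
    then show ?thesis using nat[of "x + of_int k *\<^sub>R axis i 1" "nat (- k)" i] by simp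
  qed
  have sum: "f (x + (\<Sum>i\<in>A. of_int (k i) *\<^sub>R axis i 1)) = f x" if "finite A" for A and k :: "'d \<Rightarrow> int"
    using that
  proof (induction A)
    case (insert i A)
    then show ?case
      using int[of "x + (\<Sum>i\<in>A. of_int (k i) *\<^sub>R axis i 1)" "k i" i] by (simp add: algebra_simps)
  qed simp
  have "(\<chi> i. frac (x $ i)) = x + (\<Sum>i\<in>UNIV. of_int (- \<lfloor>x $ i\<rfloor>) *\<^sub>R axis i 1)"
    by (simp add: vec_eq_iff frac_def axis_def if_distrib cong: if_cong)
  then show ?thesis using sum[OF finite] by metis
qed

lemma frac_vec_in_cbox: "(\<chi> i. frac (x $ i)) \<in> cbox 0 (1::real^'d)"
  by (auto simp: mem_box_cart less_imp_le[OF frac_lt_1])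

lemma torus_periodic_attains_sup:
  fixes f :: "real^'d \<Rightarrow> real"
  assumes "torus_periodic f" "continuous_on UNIV f"
  obtains x0 where "\<And>x. f x \<le> f x0"
proof -
  have "cbox 0 (1::real^'d) \<noteq> {}" using frac_vec_in_cbox by blast
  then obtain x0 where "\<forall>y\<in>cbox 0 1. f y \<le> f x0"
    using continuous_attains_sup[OF compact_cbox, of 0 1 f] assms(2) continuous_on_subset[of UNIV f] by auto
  then show ?thesis
    using that torus_periodic_frac[OF assms(1)] frac_vec_in_cbox by metis
qed

text \<open>No equation for f enters, only the sign of its time derivative at global spatial maxima
  of a slice. In this form the principle serves u, -u and |Du|^2 alike.\<close>

lemma parabolic_max_principle:
  fixes f :: "(real^'d) \<times> real \<Rightarrow> real"
  assumes cont: "continuous_on (UNIV \<times> {0..}) f"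
    and per: "\<And>t. t \<ge> 0 \<Longrightarrow> torus_periodic (\<lambda>x. f (x, t))"
    and ft: "\<And>x t. t > 0 \<Longrightarrow> ((\<lambda>\<tau>. f (x, \<tau>)) has_real_derivative ft x t) (at t)"
    and sub: "\<And>x t. t > 0 \<Longrightarrow> (\<And>y. f (y, t) \<le> f (x, t)) \<Longrightarrow> ft x t \<le> 0"
    and init: "\<And>x. f (x, 0) \<le> M" and "t \<ge> 0"
  shows "f (x, t) \<le> M"
proof (rule ccontr)
  assume "\<not> f (x, t) \<le> M"
  then have gt: "f (x, t) > M" by simp
  then have "t > 0" using init[of x] \<open>t \<ge> 0\<close> by (cases "t = 0") auto
  (* Subtracting e * t makes the time derivative strictly negative at a maximum point. *)
  define e where "e = (f (x, t) - M) / (2 * t)"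
  have e: "e > 0" "e * t = (f (x, t) - M) / 2" using gt \<open>t > 0\<close> by (auto simp: e_def)
  define K where "K = cbox 0 (1::real^'d) \<times> {0..t}"
  define g where "g z = f z - e * snd z" for z
  have "K \<noteq> {}" using frac_vec_in_cbox \<open>t \<ge> 0\<close> by (force simp: K_def)
  moreover have "compact K" by (simp add: K_def compact_Times)
  moreover have "continuous_on K g" unfolding g_def
    by (intro continuous_intros continuous_on_subset[OF cont]) (auto simp: K_def)
  ultimately obtain z where z: "z \<in> K" "\<And>y. y \<in> K \<Longrightarrow> g y \<le> g z"
    using continuous_attains_sup by metis
  obtain x0 t0 where zx: "z = (x0, t0)" by (cases z)
  have t0: "0 \<le> t0" "t0 \<le> t" using z zx by (auto simp: K_def)
  have max: "g (y, s) \<le> g (x0, t0)" if "0 \<le> s" "s \<le> t" for y s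
  proof -
    have "g ((\<chi> i. frac (y $ i)), s) \<le> g (x0, t0)"
      using z(2)[of "(\<chi> i. frac (y $ i), s)"] zx that frac_vec_in_cbox[of y] by (simp add: K_def)
    then show ?thesis using torus_periodic_frac[OF per[OF that(1)], of y] by (simp add: g_def)
  qed
  \<comment> \<open>By the choice of e, \<open>g (x, t)\<close> is the midpoint of M and
    \<open>f (x, t)\<close>, hence above M, while at time 0 the function g equals f and is at most
    M.\<close>
  have "t0 > 0"
  proof (rule ccontr)
    assume "\<not> t0 > 0"
    then have "g (x, t) \<le> f (x0, 0)" using max[of t x] \<open>t \<ge> 0\<close> t0 by (simp add: g_def)
    moreover have "g (x, t) = (f (x, t) + M) / 2" using e(2) by (simp add: g_def)
    ultimately show False using init[of x0] gt by simp
  qed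
  have "ft x0 t0 \<le> 0" using max[OF t0] by (intro sub \<open>t0 > 0\<close>) (simp add: g_def)
  moreover have "((\<lambda>\<tau>. g (x0, \<tau>)) has_real_derivative ft x0 t0 - e) (at t0)"
    unfolding g_def by (auto intro!: derivative_eq_intros ft \<open>t0 > 0\<close>)
  ultimately obtain d where d: "d > 0" "\<And>h. h > 0 \<Longrightarrow> h < d \<Longrightarrow> g (x0, t0) < g (x0, t0 - h)"
    using DERIV_neg_dec_left[of "\<lambda>\<tau>. g (x0, \<tau>)" "ft x0 t0 - e" t0] e(1) by auto
  \<comment> \<open>Only earlier times are compared, since t0 may be the final time t; the minimum
    with t0 keeps the time nonnegative.\<close>
  have "g (x0, t0) < g (x0, t0 - min (d / 2) t0)" using d \<open>t0 > 0\<close> by (intro d(2)) auto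
  moreover have "g (x0, t0 - min (d / 2) t0) \<le> g (x0, t0)" using t0 d(1) by (intro max) auto
  ultimately show False by simp
qed

section \<open>Slices of functions on the half space and chain rules\<close>

lemma C_on_space_slice:
  fixes f :: "(real^'d) \<times> real \<Rightarrow> real"
  defines "S \<equiv> UNIV \<times> {0..}"
  assumes "C_on (Suc k) S f" "t \<ge> 0"
  shows "((\<lambda>x. f (x, t)) has_derivative
    (\<lambda>h. \<Sum>i\<in>UNIV. h $ i * partial_on S (axis i 1, 0) f (x, t))) (at x)"
proof -
  have L: "linear (frechet_derivative f (at (x, t) within S))"
    by (rule C_on_linear_frechet_derivative[OF assms(2)]) (use assms in auto)
  have "((\<lambda>x. f (x, t)) has_derivative (\<lambda>h. frechet_derivative f (at (x, t) within S) (h, 0))) (at x)"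
    using assms(3)
    by (intro C_on_compose_has_derivative[OF assms(2), of "\<lambda>x. (x, t)"]) (auto simp: S_def intro!: derivative_eq_intros)
  moreover have "frechet_derivative f (at (x, t) within S) (h, 0)
      = (\<Sum>i\<in>UNIV. h $ i * partial_on S (axis i 1, 0) f (x, t))" for h
  proof -
    have "(h, 0) = (\<Sum>i\<in>UNIV. (h $ i) *\<^sub>R (axis i 1 :: real^'d, 0::real))"
      by (simp add: prod_eq_iff fst_sum snd_sum basis_expansion flip: scalar_mult_eq_scaleR)
    then show ?thesis
      using L by (simp only: linear_sum linear_cmul partial_on_def real_scaleR_def)
  qed
  ultimately show ?thesis by simp
qed

lemma C_on_time_slice:
  fixes f :: "(real^'d) \<times> real \<Rightarrow> real"
  defines "S \<equiv> UNIV \<times> {0..}"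
  assumes "C_on (Suc k) S f" "t > 0"
  shows "((\<lambda>\<tau>. f (x, \<tau>)) has_real_derivative partial_on S (0, 1) f (x, t)) (at t)"
proof -
  have "((\<lambda>\<tau>. f ((x, t) + \<tau> *\<^sub>R (0, 1))) has_real_derivative partial_on S (0, 1) f (x, t)) (at 0)"
    using assms
    by (intro C_on_has_line_derivative[OF assms(2), of "UNIV \<times> {0<..}"]) (auto intro!: open_Times)
  then show ?thesis
    using DERIV_shift[of "\<lambda>\<tau>. f (x, \<tau>)" "partial_on S (0, 1) f (x, t)" 0 t] by (simp add: add.commute)
qed

lemma C_on_compose_pair:
  fixes R :: "(real \<times> real) set" and V W :: "'a::real_normed_vector \<Rightarrow> real"
  assumes "C_on (Suc k) R \<psi>" "(V has_derivative V') (at x within T)" "(W has_derivative W') (at x within T)"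
    and "\<And>y. y \<in> T \<Longrightarrow> (V y, W y) \<in> R" "x \<in> T"
  shows "((\<lambda>y. \<psi> (V y, W y)) has_derivative
    (\<lambda>h. partial_on R (1, 0) \<psi> (V x, W x) * V' h + partial_on R (0, 1) \<psi> (V x, W x) * W' h)) (at x within T)"
proof -
  let ?D = "frechet_derivative \<psi> (at (V x, W x) within R)"
  have L: "linear ?D" by (rule C_on_linear_frechet_derivative[OF assms(1)]) (use assms in auto)
  have "?D (a, b) = partial_on R (1, 0) \<psi> (V x, W x) * a + partial_on R (0, 1) \<psi> (V x, W x) * b" for a b
  proof -
    have "(a, b) = a *\<^sub>R (1, 0) + b *\<^sub>R (0, 1)" by simp
    then show ?thesis
      using L by (simp only: linear_add linear_cmul partial_on_def real_scaleR_def mult.commute)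
  qed
  moreover have "((\<lambda>y. \<psi> (V y, W y)) has_derivative (\<lambda>h. ?D (V' h, W' h))) (at x within T)"
    using assms(4,5)
    by (intro C_on_compose_has_derivative[OF assms(1), of "\<lambda>y. (V y, W y)"] has_derivative_Pair assms(2,3)) auto
  ultimately show ?thesis by simp
qed

lemma divergence_eq:
  assumes "\<And>i. ((\<lambda>y. F y $ i) has_derivative F' i) (at x)"
  shows "divergence F x = (\<Sum>i\<in>UNIV. F' i (axis i 1))"
  using frechet_derivative_at[OF assms] by (simp add: divergence_def partial_on_def)

lemma grad_eq:
  assumes "(v has_derivative (\<lambda>h. \<Sum>i\<in>UNIV. h $ i * p i)) (at x)"
  shows "grad v x = (\<chi> i. p i)"
  using frechet_derivative_at[OF assms, symmetric] by (simp add: grad_def partial_on_def)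

section \<open>The equation at a fixed time\<close>

(* v is the solution at a fixed time, and p i, q i j, r k i j stand for its partial derivatives
   D_i v, D_i D_j v, D_k D_i D_j v. *)
locale diffusion_slice =
  fixes \<psi> :: "real \<times> real \<Rightarrow> real" and R :: "(real \<times> real) set"
    and v :: "real^'d \<Rightarrow> real" and p :: "'d \<Rightarrow> real^'d \<Rightarrow> real"
    and q :: "'d \<Rightarrow> 'd \<Rightarrow> real^'d \<Rightarrow> real" and r :: "'d \<Rightarrow> 'd \<Rightarrow> 'd \<Rightarrow> real^'d \<Rightarrow> real"
  assumes \<psi>: "C_on 2 R \<psi>"
    and v: "\<And>x. (v has_derivative (\<lambda>h. \<Sum>i\<in>UNIV. h $ i * p i x)) (at x)"
    and p: "\<And>j x. (p j has_derivative (\<lambda>h. \<Sum>i\<in>UNIV. h $ i * q i j x)) (at x)"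
    and q: "\<And>i j x. (q i j has_derivative (\<lambda>h. \<Sum>k\<in>UNIV. h $ k * r k i j x)) (at x)"
    and range_sum: "\<And>x. (v x, \<Sum>j\<in>UNIV. (p j x)\<^sup>2) \<in> R"
begin

text \<open>These are |Dv|^2 and its partial derivatives D_i and D_k D_i. With M the matrix of the
  \<open>q i j\<close>, the vector of the \<open>Wx i\<close> is 2 M p, so a critical point of W is
  a point where M p = 0.\<close>

definition "W x = (\<Sum>j\<in>UNIV. (p j x)\<^sup>2)"
definition "Wx i x = 2 * (\<Sum>j\<in>UNIV. p j x * q i j x)"
definition "Wxx k i x = 2 * (\<Sum>j\<in>UNIV. q k j x * q i j x + p j x * r k i j x)"

abbreviation "flux \<equiv> \<lambda>y. \<psi> (v y, (norm (grad v y))\<^sup>2) *\<^sub>R grad v y"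

lemma range: "(v x, W x) \<in> R"
  using range_sum by (simp add: W_def)

lemma norm_grad_square: "(norm (grad v x))\<^sup>2 = W x"
  unfolding grad_eq[OF v] power2_norm_eq_inner by (simp add: inner_vec_def W_def power2_eq_square)

lemma W_derivative: "(W has_derivative (\<lambda>h. \<Sum>i\<in>UNIV. h $ i * Wx i x)) (at x)"
proof -
  have "(W has_derivative (\<lambda>h. \<Sum>j\<in>UNIV. 2 * p j x * (\<Sum>i\<in>UNIV. h $ i * q i j x))) (at x)"
    unfolding W_def[abs_def] by (auto intro!: derivative_eq_intros p sum.cong simp: mult_ac)
  moreover have "(\<Sum>j\<in>UNIV. 2 * p j x * (\<Sum>i\<in>UNIV. h $ i * q i j x)) = (\<Sum>i\<in>UNIV. h $ i * Wx i x)" for h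
    unfolding Wx_def sum_distrib_left by (subst sum.swap) (simp add: mult_ac)
  ultimately show ?thesis by simp
qed

lemma Wx_derivative: "(Wx i has_derivative (\<lambda>h. \<Sum>k\<in>UNIV. h $ k * Wxx k i x)) (at x)"
proof -
  have "(Wx i has_derivative (\<lambda>h. 2 * (\<Sum>j\<in>UNIV. p j x * (\<Sum>k\<in>UNIV. h $ k * r k i j x)
      + (\<Sum>k\<in>UNIV. h $ k * q k j x) * q i j x))) (at x)"
    unfolding Wx_def[abs_def] by (auto intro!: derivative_eq_intros p q)
  moreover have "2 * (\<Sum>j\<in>UNIV. p j x * (\<Sum>k\<in>UNIV. h $ k * r k i j x)
      + (\<Sum>k\<in>UNIV. h $ k * q k j x) * q i j x) = (\<Sum>k\<in>UNIV. h $ k * Wxx k i x)" for h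
    unfolding Wxx_def sum_distrib_left sum_distrib_right sum.distrib[symmetric]
    by (subst sum.swap) (simp add: algebra_simps)
  ultimately show ?thesis by simp
qed

text \<open>The non-divergence form of the right-hand side. At an extremum of v its first two terms
  vanish, and differentiating it once more involves only derivatives of \<open>\<psi>\<close> of
  order at most two.\<close>

lemma divergence_flux:
  "divergence flux x = partial_on R (1, 0) \<psi> (v x, W x) * W x
    + partial_on R (0, 1) \<psi> (v x, W x) * (\<Sum>i\<in>UNIV. Wx i x * p i x) + \<psi> (v x, W x) * (\<Sum>i\<in>UNIV. q i i x)"
proof -
  define a where "a = partial_on R (1, 0) \<psi> (v x, W x)"
  define b where "b = partial_on R (0, 1) \<psi> (v x, W x)"
  have \<psi>': "C_on (Suc (Suc 0)) R \<psi>" using \<psi> by (simp add: numeral_2_eq_2)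
  have D: "((\<lambda>y. \<psi> (v y, W y)) has_derivative
      (\<lambda>h. a * (\<Sum>i\<in>UNIV. h $ i * p i x) + b * (\<Sum>i\<in>UNIV. h $ i * Wx i x))) (at x)"
    unfolding a_def b_def using range by (intro C_on_compose_pair[OF \<psi>' v W_derivative]) auto
  have "((\<lambda>y. flux y $ i) has_derivative
      (\<lambda>h. \<psi> (v x, W x) * (\<Sum>k\<in>UNIV. h $ k * q k i x)
        + (a * (\<Sum>i\<in>UNIV. h $ i * p i x) + b * (\<Sum>i\<in>UNIV. h $ i * Wx i x)) * p i x)) (at x)" for i
    unfolding norm_grad_square unfolding grad_eq[OF v]
    using has_derivative_mult[OF D p[of i]] by simp
  from divergence_eq[OF this, unfolded sum_axis_mult]
  have "divergence flux x = \<psi> (v x, W x) * (\<Sum>i\<in>UNIV. q i i x)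
      + a * (\<Sum>i\<in>UNIV. p i x * p i x) + b * (\<Sum>i\<in>UNIV. Wx i x * p i x)"
    by (simp add: sum.distrib sum_distrib_left sum_distrib_right algebra_simps)
  moreover have "(\<Sum>i\<in>UNIV. p i x * p i x) = W x" by (simp add: W_def power2_eq_square)
  ultimately show ?thesis by (simp add: a_def b_def)
qed

lemma divergence_flux_at_max:
  assumes max: "\<And>y. v y \<le> v x" and "\<psi> (v x, W x) \<ge> 0"
  shows "divergence flux x \<le> 0"
proof -
  have p0: "p i x = 0" for i by (rule second_order_max(1)[OF v p max])
  have "h \<bullet> ((\<chi> k i. q k i x) *v h) \<le> 0" for h by (rule second_order_max(2)[OF v p max])
  then have "trace (\<chi> k i. q k i x) \<le> 0" by (rule trace_nonpos_of_negative_semidefinite)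
  then show ?thesis
    using assms(2) unfolding divergence_flux by (simp add: p0 W_def trace_def mult_nonneg_nonpos)
qed

text \<open>The statement at a maximum cannot simply be applied to -v, because \<open>\<psi>\<close>
  depends on v; only the second-order criterion is applied to -v.\<close>

lemma divergence_flux_at_min:
  assumes min: "\<And>y. v x \<le> v y" and "\<psi> (v x, W x) \<ge> 0"
  shows "divergence flux x \<ge> 0"
proof -
  have v': "((\<lambda>x. - v x) has_derivative (\<lambda>h. \<Sum>i\<in>UNIV. h $ i * - p i x)) (at x)" for x
    using has_derivative_minus[OF v] by (simp add: sum_negf)
  have p': "((\<lambda>x. - p j x) has_derivative (\<lambda>h. \<Sum>i\<in>UNIV. h $ i * - q i j x)) (at x)" for j x
    using has_derivative_minus[OF p] by (simp add: sum_negf)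
  have max': "- v y \<le> - v x" for y using min by simp
  have p0: "p i x = 0" for i using second_order_max(1)[OF v' p' max'] by simp
  have "h \<bullet> ((\<chi> k i. - q k i x) *v h) \<le> 0" for h by (rule second_order_max(2)[OF v' p' max'])
  then have "trace (\<chi> k i. - q k i x) \<le> 0" by (rule trace_nonpos_of_negative_semidefinite)
  then show ?thesis
    using assms(2) unfolding divergence_flux by (simp add: p0 W_def trace_def sum_negf)
qed

text \<open>When the divergence is u_t at a fixed time, \<open>G\<close> in direction p is p . D
  u_t, half the time derivative of |Du|^2. The assumption \<open>sym\<close> is there because
  differentiating tr M produces D_j D_i D_i v, while the trace of the Hessian of W contains D_i D_i
  D_j v.\<close>

lemma divergence_flux_derivative_at_gradient_max:
  assumes max: "\<And>y. W y \<le> W x"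
    and G: "(divergence flux has_derivative G) (at x)"
    and sym: "\<And>i j. r i i j x = r j i i x"
    and nonneg: "\<psi> (v x, W x) \<ge> 0"
    and elliptic: "\<psi> (v x, W x) + 2 * W x * partial_on R (0, 1) \<psi> (v x, W x) \<ge> 0"
    and conc: "partial_on R (1, 0) (partial_on R (1, 0) \<psi>) (v x, W x) \<le> 0"
    and cond: "(real CARD('d) - 1) / 4 * (partial_on R (1, 0) \<psi> (v x, W x))\<^sup>2
           \<le> - \<psi> (v x, W x) * partial_on R (1, 0) (partial_on R (1, 0) \<psi>) (v x, W x)"
  shows "G (\<chi> i. p i x) \<le> 0"
proof -
  define a where "a = \<psi> (v x, W x)"
  define b where "b = partial_on R (0, 1) \<psi> (v x, W x)"
  define c where "c = partial_on R (1, 0) \<psi> (v x, W x)"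
  define cc where "cc = partial_on R (1, 0) (partial_on R (1, 0) \<psi>) (v x, W x)"
  define e where "e = (\<chi> i. p i x)"
  define M where "M = (\<chi> i j. q i j x)"
  define H where "H = (\<chi> k i. Wxx k i x)"
  have ee: "e \<bullet> e = W x" by (simp add: e_def inner_vec_def W_def power2_eq_square)
  have Wx0: "Wx i x = 0" for i by (rule second_order_max(1)[OF W_derivative Wx_derivative max])
  have neg: "h \<bullet> (H *v h) \<le> 0" for h
    unfolding H_def by (rule second_order_max(2)[OF W_derivative Wx_derivative max])
  have \<psi>2: "C_on (Suc (Suc 0)) R \<psi>" using \<psi> by (simp add: numeral_2_eq_2)
  have \<psi>1: "C_on (Suc 0) R (partial_on R (1, 0) \<psi>)" "C_on (Suc 0) R (partial_on R (0, 1) \<psi>)"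
    by (rule C_on_partial_on[OF \<psi>2], simp add: Basis_prod_def)+
  \<comment> \<open>As DW vanishes at x, only the derivative in the first argument survives, which
    keeps psi_us and psi_ss out of the computation.\<close>
  have D: "((\<lambda>y. f (v y, W y)) has_derivative (\<lambda>h. partial_on R (1, 0) f (v x, W x) * (h \<bullet> e))) (at x)"
    if "C_on (Suc k) R f" for f k
    using C_on_compose_pair[OF that v[of x] W_derivative[of x]] range
    by (simp add: Wx0 e_def inner_vec_def)
  have G': "G = (\<lambda>h. c * 0 + cc * (h \<bullet> e) * W x
      + (b * (\<Sum>i\<in>UNIV. (\<Sum>k\<in>UNIV. h $ k * Wxx k i x) * p i x))
      + (a * (\<Sum>i\<in>UNIV. \<Sum>k\<in>UNIV. h $ k * r k i i x) + c * (h \<bullet> e) * (\<Sum>i\<in>UNIV. q i i x)))"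
  proof (rule has_derivative_unique[OF G])
    have W0: "(W has_derivative (\<lambda>h. 0)) (at x)" using W_derivative[of x] by (simp add: Wx0)
    show "(divergence flux has_derivative (\<lambda>h. c * 0 + cc * (h \<bullet> e) * W x
      + (b * (\<Sum>i\<in>UNIV. (\<Sum>k\<in>UNIV. h $ k * Wxx k i x) * p i x))
      + (a * (\<Sum>i\<in>UNIV. \<Sum>k\<in>UNIV. h $ k * r k i i x) + c * (h \<bullet> e) * (\<Sum>i\<in>UNIV. q i i x)))) (at x)"
      unfolding divergence_flux[abs_def] a_def b_def c_def cc_def
      by (rule derivative_eq_intros D[OF \<psi>2] D[OF \<psi>1(1)] D[OF \<psi>1(2)] W0 Wx_derivative p q refl)+
         (simp add: Wx0)
  qed
  \<comment> \<open>Bochner's identity in flat space: half the Laplacian of |Dv|^2 is |M|^2 + p .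
    D(tr M). It trades the third derivatives in \<open>G\<close> for the trace of H.\<close>
  have tr: "trace H = 2 * (M \<bullet> M) + 2 * (\<Sum>i\<in>UNIV. \<Sum>k\<in>UNIV. e $ k * r k i i x)"
  proof -
    have "(\<Sum>i\<in>UNIV. \<Sum>k\<in>UNIV. e $ k * r k i i x) = (\<Sum>i\<in>UNIV. \<Sum>j\<in>UNIV. p j x * r i i j x)"
      by (intro sum.cong refl) (metis sym e_def vec_lambda_beta)
    then show ?thesis
      by (simp add: trace_def H_def M_def Wxx_def inner_vec_def sum.distrib sum_distrib_left)
  qed
  have eHe: "(\<Sum>i\<in>UNIV. (\<Sum>k\<in>UNIV. e $ k * Wxx k i x) * p i x) = e \<bullet> (H *v e)"
    unfolding sum_distrib_right
    by (subst sum.swap) (simp add: H_def e_def inner_vec_def matrix_vector_mult_def sum_distrib_left mult_ac)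
  have trM: "(\<Sum>i\<in>UNIV. q i i x) = trace M" by (simp add: M_def trace_def)
  have "G e = (cc * (W x)\<^sup>2 + c * W x * trace M - a * (M \<bullet> M)) + (a * trace H + 2 * b * (e \<bullet> (H *v e))) / 2"
    unfolding G' eHe trM ee tr by (simp add: field_simps power2_eq_square)
  moreover have "a * trace H + 2 * b * (e \<bullet> (H *v e)) \<le> 0"
    using elliptic_trace_nonpos[OF neg, of a e b] nonneg elliptic by (simp add: ee a_def b_def)
  moreover have "cc * (W x)\<^sup>2 + c * W x * trace M - a * (M \<bullet> M) \<le> 0"
  \<comment> \<open>The trace inequality needs a nonzero kernel vector. If p = 0 then W = 0 and only
    the term -a |M|^2 remains.\<close>
  proof (cases "e = 0")
    case True
    then have "W x = 0" using ee by simp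
    then show ?thesis using nonneg by (simp add: a_def)
  next
    case False
    have "M *v e = 0"
      using Wx0 by (simp add: vec_eq_iff matrix_vector_mult_def M_def e_def Wx_def mult.commute)
    from trace_square_le_of_kernel[OF this False] show ?thesis
      using nonneg cond conc by (intro quadratic_form_nonpos) (auto simp: a_def c_def cc_def Suc_le_eq)
  qed
  moreover have "A + B / 2 \<le> 0" if "B \<le> 0" "A \<le> 0" for A B :: real using that by linarith
  ultimately have "G e \<le> 0" by metis
  then show ?thesis by (simp add: e_def)
qed

end

text \<open>Lets an identity known only for t > 0, such as the interchange of two derivatives, be
  used underneath a further derivative.\<close>

lemma partial_on_cong_open:
  assumes "C_on (Suc k) S f" "open U" "U \<subseteq> S" "z \<in> U" "\<And>y. y \<in> U \<Longrightarrow> f y = g y"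
  shows "partial_on S b f z = partial_on S b g z"
proof -
  have at: "at z within S = at z"
    using assms interior_maximal by (intro at_within_interior) blast
  have "f differentiable at z within S"
    using assms by (auto simp: differentiable_on_def)
  then have "f differentiable at z" unfolding at .
  from frechet_derivative_transform_within_open[OF this assms(2,4,5)]
  show ?thesis by (simp add: partial_on_def at)
qed

lemma torus_periodic_partial_derivative:
  fixes f :: "real^'d \<Rightarrow> real"
  assumes f: "torus_periodic f" and D: "\<And>x. (f has_derivative (\<lambda>h. \<Sum>i\<in>UNIV. h $ i * p i x)) (at x)"
  shows "torus_periodic (p j)"
  unfolding torus_periodic_def
proof (intro allI)
  fix x :: "real^'d" and i
  have "((\<lambda>y. y + axis i 1) has_derivative (\<lambda>h. h)) (at x)" by (auto intro!: derivative_eq_intros)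
  from has_derivative_compose[of "\<lambda>y::real^'d. y + axis i 1" "\<lambda>h. h" x UNIV f, OF this D[of "x + axis i 1"]]
  have "(f has_derivative (\<lambda>h. \<Sum>k\<in>UNIV. h $ k * p k (x + axis i 1))) (at x)"
    using f by (simp add: torus_periodic_def)
  from fun_cong[OF has_derivative_unique[OF this D], of "axis j 1"]
  show "p j (x + axis i 1) = p j x" by simp
qed

text \<open>With s frozen this is a one-variable statement about the function \<open>\<psi>\<close>
  of v. A whole interval of values v is used, because at a single zero of \<open>\<psi>\<close> the
  product condition carries no information.\<close>

lemma second_partial_nonpos:
  fixes \<psi> :: "real \<times> real \<Rightarrow> real"
  assumes \<psi>: "C_on 2 ({a..b} \<times> J) \<psi>" and "a < b" and vs: "v \<in> {a..b}" "s \<in> J"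
    and nonneg: "\<And>v. v \<in> {a..b} \<Longrightarrow> \<psi> (v, s) \<ge> 0"
    and prod: "\<And>v. v \<in> {a..b} \<Longrightarrow>
      \<psi> (v, s) * partial_on ({a..b} \<times> J) (1, 0) (partial_on ({a..b} \<times> J) (1, 0) \<psi>) (v, s) \<le> 0"
  shows "partial_on ({a..b} \<times> J) (1, 0) (partial_on ({a..b} \<times> J) (1, 0) \<psi>) (v, s) \<le> 0"
proof -
  let ?R = "{a..b} \<times> J"
  have \<psi>2: "C_on (Suc (Suc 0)) ?R \<psi>" using \<psi> by (simp add: numeral_2_eq_2)
  have \<psi>1: "C_on (Suc 0) ?R (partial_on ?R (1, 0) \<psi>)"
    by (rule C_on_partial_on[OF \<psi>2]) (simp add: Basis_prod_def)
  have \<psi>0: "C_on 0 ?R (partial_on ?R (1, 0) (partial_on ?R (1, 0) \<psi>))"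
    by (rule C_on_partial_on[OF \<psi>1]) (simp add: Basis_prod_def)
  have slice: "((\<lambda>v. f (v, s)) has_real_derivative partial_on ?R (1, 0) f (v, s)) (at v within {a..b})"
    if "C_on (Suc k) ?R f" "v \<in> {a..b}" for f k v
    using C_on_compose_pair[OF that(1) has_derivative_ident has_derivative_const, of "{a..b}" s v] that vs
    by (simp add: has_field_derivative_def)
  have "continuous_on {a..b} (\<lambda>v. partial_on ?R (1, 0) (partial_on ?R (1, 0) \<psi>) (v, s))"
    by (rule continuous_on_compose2[OF C_on_imp_continuous_on[OF \<psi>0]])
       (use vs in \<open>auto intro!: continuous_intros\<close>)
  from second_derivative_nonpos_of_product[OF \<open>a < b\<close> slice[OF \<psi>2] slice[OF \<psi>1] this nonneg prod vs(1)]
  show ?thesis .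
qed

theorem corollary3p3:
  fixes ulow uhigh L :: real
    and \<psi> :: "real \<times> real \<Rightarrow> real"
    and u :: "(real^'d) \<times> real \<Rightarrow> real"
    and u0 :: "real^'d \<Rightarrow> real"
  defines "R \<equiv> {ulow..uhigh} \<times> {0..L}"
  assumes "ulow < uhigh" and "L > 0"
    and "C_on 2 R \<psi>"
    and "\<forall>(v, s)\<in>R. \<psi> (v, s) \<ge> 0 \<and> \<psi> (v, s) + 2 * s * partial_on R (0, 1) \<psi> (v, s) \<ge> 0"
    and "\<forall>(v, s)\<in>R. (real CARD('d) - 1) / 4 * (partial_on R (1, 0) \<psi> (v, s))\<^sup>2
           \<le> - \<psi> (v, s) * partial_on R (1, 0) (partial_on R (1, 0) \<psi>) (v, s)"
    and "\<forall>t\<ge>0. torus_periodic (\<lambda>x. u (x, t))"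
    and "C_on 3 (UNIV \<times> {0..}) u"
    and "\<forall>x. \<forall>t>0. deriv (\<lambda>\<tau>. u (x, \<tau>)) t =
           divergence (\<lambda>y. \<psi> (u (y, t), (norm (grad (\<lambda>z. u (z, t)) y))\<^sup>2)
                              *\<^sub>R grad (\<lambda>z. u (z, t)) y) x"
    and "\<forall>x. u (x, 0) = u0 x"
    and "\<forall>t\<ge>0. (\<forall>x. ulow \<le> u (x, t) \<and> u (x, t) \<le> uhigh)
           \<and> sup_norm (grad (\<lambda>x. u (x, t))) \<le> sqrt L"
  shows "\<forall>t\<ge>0. (\<forall>x. (LEAST m. m \<in> range u0) \<le> u (x, t) \<and> u (x, t) \<le> (GREATEST m. m \<in> range u0))
           \<and> sup_norm (grad (\<lambda>x. u (x, t))) \<le> sup_norm (grad u0)"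
proof -
  note \<psi> = assms(4) and cond1 = assms(5) and cond2 = assms(6) and per = assms(7)[rule_format]
    and pde = assms(9)[rule_format] and init = assms(10)[rule_format] and bounds = assms(11)[rule_format]

  \<comment> \<open>The derivatives of u and the range of (u, |Du|^2)\<close>
  define S where "S = (UNIV :: (real^'d) set) \<times> {0::real..}"
  define U where "U = (UNIV :: (real^'d) set) \<times> {0::real<..}"
  have U: "open U" "U \<subseteq> S" by (auto simp: U_def S_def intro!: open_Times)
  define be where "be i = (axis i 1 :: real^'d, 0::real)" for i
  define bt where "bt = (0 :: real^'d, 1::real)"
  have be: "be i \<in> Basis" for i by (auto simp: be_def Basis_prod_def Basis_vec_def)
  have bt: "bt \<in> Basis" by (auto simp: bt_def Basis_prod_def)
  \<comment> \<open>The leftmost index is the outermost derivative: \<open>T k i j\<close> is D_k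
    D_i D_j u.\<close>
  define P where "P j = partial_on S (be j) u" for j
  define Q where "Q i j = partial_on S (be i) (P j)" for i j
  define T where "T k i j = partial_on S (be k) (Q i j)" for k i j
  define ut where "ut = partial_on S bt u"
  have Cu: "C_on (Suc (Suc (Suc 0))) S u" using assms(8) by (simp add: S_def numeral_3_eq_3)
  have CP: "C_on (Suc (Suc 0)) S (P j)" for j unfolding P_def by (rule C_on_partial_on[OF Cu be])
  have CQ: "C_on (Suc 0) S (Q i j)" for i j unfolding Q_def by (rule C_on_partial_on[OF CP be])
  have Cut: "C_on (Suc (Suc 0)) S ut" unfolding ut_def by (rule C_on_partial_on[OF Cu bt])
  note space = C_on_space_slice[where 'd = 'd, folded S_def be_def] and time = C_on_time_slice[where 'd = 'd, folded S_def bt_def]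
  have Dv: "((\<lambda>x. u (x, t)) has_derivative (\<lambda>h. \<Sum>i\<in>UNIV. h $ i * P i (x, t))) (at x)" if "t \<ge> 0" for t x
    unfolding P_def by (rule space[OF Cu that])
  define w where "w z = (\<Sum>j\<in>UNIV. (P j z)\<^sup>2)" for z
  have grad_w: "norm (grad (\<lambda>x. u (x, t)) x) = sqrt (w (x, t))" if "t \<ge> 0" for t x
    unfolding grad_eq[OF Dv[OF that]] by (simp add: norm_vec_def L2_set_def w_def)
  have w_cont: "continuous_on S w"
    unfolding w_def using C_on_imp_continuous_on[OF CP] by (auto intro!: continuous_intros)
  have w_slice_cont: "continuous_on UNIV (\<lambda>x. w (x, t))" if "t \<ge> 0" for t
    by (rule continuous_on_compose2[OF w_cont]) (use that in \<open>auto simp: S_def intro!: continuous_intros\<close>)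
  have w_per: "torus_periodic (\<lambda>x. w (x, t))" if "t \<ge> 0" for t
    using torus_periodic_partial_derivative[OF per[OF that] Dv[OF that]]
    by (simp add: torus_periodic_def w_def)
  have w_nonneg: "w z \<ge> 0" for z by (simp add: w_def sum_nonneg)
  \<comment> \<open>A bound on the real supremum yields pointwise bounds only for a set known to be
    bounded above; periodicity and continuity supply this.\<close>
  have bdd: "bdd_above (range (\<lambda>x. norm (grad (\<lambda>x. u (x, t)) x)))" if t: "t \<ge> 0" for t
  proof -
    obtain x0 where "\<And>x. w (x, t) \<le> w (x0, t)"
      using torus_periodic_attains_sup[OF w_per[OF t] w_slice_cont[OF t]] by blast
    then show ?thesis by (intro bdd_aboveI[of _ "sqrt (w (x0, t))"]) (auto simp: grad_w[OF t])
  qed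
  have sup_upper: "sqrt (w (x, t)) \<le> sup_norm (grad (\<lambda>x. u (x, t)))" if "t \<ge> 0" for t x
    unfolding sup_norm_def grad_w[OF that, symmetric] by (rule cSUP_upper[OF UNIV_I bdd[OF that]])
  have in_R: "(u (x, t), w (x, t)) \<in> R" if "t \<ge> 0" for t x
  proof -
    have "sqrt (w (x, t)) \<le> sqrt L" using sup_upper[OF that, of x] bounds[OF that] by linarith
    then show ?thesis using bounds[OF that] w_nonneg by (simp add: R_def)
  qed
  have slice: "diffusion_slice \<psi> R (\<lambda>x. u (x, t)) (\<lambda>i x. P i (x, t)) (\<lambda>i j x. Q i j (x, t))
      (\<lambda>k i j x. T k i j (x, t))" if "t \<ge> 0" for t
  proof
    show "C_on 2 R \<psi>" by (rule \<psi>)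
    show "((\<lambda>x. P j (x, t)) has_derivative (\<lambda>h. \<Sum>i\<in>UNIV. h $ i * Q i j (x, t))) (at x)" for j x
      unfolding Q_def by (rule space[OF CP that])
    show "((\<lambda>x. Q i j (x, t)) has_derivative (\<lambda>h. \<Sum>k\<in>UNIV. h $ k * T k i j (x, t))) (at x)" for i j x
      unfolding T_def by (rule space[OF CQ that])
  qed (use Dv[OF that] in_R[OF that] in \<open>auto simp: w_def\<close>)
  have W: "diffusion_slice.W (\<lambda>i x. P i (x, t)) x = w (x, t)" if "t \<ge> 0" for t x
    by (simp add: diffusion_slice.W_def[OF slice[OF that]] w_def)
  have u_t: "ut (x, t) = divergence (\<lambda>y. \<psi> (u (y, t), (norm (grad (\<lambda>z. u (z, t)) y))\<^sup>2)
      *\<^sub>R grad (\<lambda>z. u (z, t)) y) x" if "t > 0" for x t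
    using DERIV_imp_deriv[OF time[OF Cu that]] pde[OF that] by (simp add: ut_def)
  have \<psi>_nonneg: "\<psi> (u (x, t), w (x, t)) \<ge> 0" if "t \<ge> 0" for x t
    using cond1 in_R[OF that] by auto
  have u_cont: "continuous_on S u" by (rule C_on_imp_continuous_on[OF Cu])
  have u0: "u0 = (\<lambda>x. u (x, 0))" using init by auto
  have u0_cont: "continuous_on UNIV u0" unfolding u0
    by (rule continuous_on_compose2[OF u_cont]) (auto simp: S_def intro!: continuous_intros)
  have u0_per: "torus_periodic u0" unfolding u0 by (rule per) simp

  \<comment> \<open>The bounds on u\<close>
  have upper: "u (x, t) \<le> (GREATEST m. m \<in> range u0)" if t: "t \<ge> 0" for x t
  proof -
    obtain x0 where x0: "\<And>x. u0 x \<le> u0 x0" using torus_periodic_attains_sup[OF u0_per u0_cont] by blast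
    have "(GREATEST m. m \<in> range u0) = u0 x0" by (rule Greatest_equality) (use x0 in auto)
    moreover have "u (x, t) \<le> u0 x0"
    proof (rule parabolic_max_principle[OF u_cont[unfolded S_def] per])
      show "((\<lambda>\<tau>. u (x, \<tau>)) has_real_derivative ut (x, t)) (at t)" if "t > 0" for x t
        unfolding ut_def by (rule time[OF Cu that])
      show "ut (x, t) \<le> 0" if "t > 0" "\<And>y. u (y, t) \<le> u (x, t)" for x t
      proof -
        interpret diffusion_slice \<psi> R "\<lambda>x. u (x, t)" "\<lambda>i x. P i (x, t)" "\<lambda>i j x. Q i j (x, t)"
          "\<lambda>k i j x. T k i j (x, t)" using slice that by simp
        show ?thesis unfolding u_t[OF that(1)]
          using \<psi>_nonneg that W by (intro divergence_flux_at_max) auto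
      qed
    qed (use x0 init t in auto)
    ultimately show ?thesis by simp
  qed

  have lower: "(LEAST m. m \<in> range u0) \<le> u (x, t)" if t: "t \<ge> 0" for x t
  proof -
    have "torus_periodic (\<lambda>x. - u0 x)" using u0_per by (simp add: torus_periodic_def)
    moreover have "continuous_on UNIV (\<lambda>x. - u0 x)" by (intro continuous_intros u0_cont)
    ultimately obtain x0 where "\<And>x. - u0 x \<le> - u0 x0" using torus_periodic_attains_sup by blast
    then have x0: "\<And>x. u0 x0 \<le> u0 x" by simp
    have "(LEAST m. m \<in> range u0) = u0 x0" by (rule Least_equality) (use x0 in auto)
    moreover have "- u (x, t) \<le> - u0 x0"
    proof (rule parabolic_max_principle[where f = "\<lambda>z. - u z"])
      show "continuous_on (UNIV \<times> {0..}) (\<lambda>z. - u z)"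
        using u_cont unfolding S_def by (intro continuous_intros)
      show "torus_periodic (\<lambda>x. - u (x, t))" if "t \<ge> 0" for t
        using per[OF that] by (simp add: torus_periodic_def)
      show "((\<lambda>\<tau>. - u (x, \<tau>)) has_real_derivative - ut (x, t)) (at t)" if "t > 0" for x t
        unfolding ut_def by (rule DERIV_minus[OF time[OF Cu that]])
      show "- ut (x, t) \<le> 0" if "t > 0" "\<And>y. - u (y, t) \<le> - u (x, t)" for x t
      proof -
        interpret diffusion_slice \<psi> R "\<lambda>x. u (x, t)" "\<lambda>i x. P i (x, t)" "\<lambda>i j x. Q i j (x, t)"
          "\<lambda>k i j x. T k i j (x, t)" using slice that by simp
        have "ut (x, t) \<ge> 0" unfolding u_t[OF that(1)]
          using \<psi>_nonneg that W by (intro divergence_flux_at_min) auto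
        then show ?thesis by simp
      qed
    qed (use x0 init t in auto)
    ultimately show ?thesis by simp
  qed

  \<comment> \<open>Symmetry of third derivatives and concavity of \<open>\<psi>\<close> in
    u\<close>
  have symm: "T i i j z = T j i i z" if z: "z \<in> U" for i j z
  proof -
    \<comment> \<open>Two interchanges: the inner one takes place under the outer D_i and so needs
      equality on an open set; the outer one is Schwarz's theorem for D_i u.\<close>
    have "T i i j z = T i j i z" unfolding T_def
      by (rule partial_on_cong_open[OF CQ U z]) (simp add: Q_def P_def partial_on_commute[OF Cu U _ be be])
    also have "\<dots> = T j i i z" unfolding T_def Q_def by (rule partial_on_commute[OF CP U z be be])
    finally show ?thesis .
  qed
  have conc: "partial_on R (1, 0) (partial_on R (1, 0) \<psi>) (v, s) \<le> 0" if vs: "(v, s) \<in> R" for v s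
    unfolding R_def
  proof (rule second_partial_nonpos)
    show "C_on 2 ({ulow..uhigh} \<times> {0..L}) \<psi>" using \<psi> by (simp add: R_def)
    fix v assume "v \<in> {ulow..uhigh}"
    then have vs': "(v, s) \<in> R" using vs by (simp add: R_def)
    show "\<psi> (v, s) \<ge> 0" using cond1 vs' by auto
    \<comment> \<open>Discarding the square in (iii), which is nonnegative since d is at least 1,
      leaves the product condition.\<close>
    have "0 \<le> (real CARD('d) - 1) / 4 * (partial_on R (1, 0) \<psi> (v, s))\<^sup>2"
      by (simp add: Suc_le_eq)
    also have "\<dots> \<le> - \<psi> (v, s) * partial_on R (1, 0) (partial_on R (1, 0) \<psi>) (v, s)"
      using cond2 vs' by auto
    finally show "\<psi> (v, s) * partial_on ({ulow..uhigh} \<times> {0..L}) (1, 0)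
        (partial_on ({ulow..uhigh} \<times> {0..L}) (1, 0) \<psi>) (v, s) \<le> 0"
      by (simp add: R_def)
  qed (use vs \<open>ulow < uhigh\<close> in \<open>auto simp: R_def\<close>)

  \<comment> \<open>The gradient bound\<close>
  have gradient: "w (x, t) \<le> (sup_norm (grad u0))\<^sup>2" if t: "t \<ge> 0" for x t
  proof (rule parabolic_max_principle[OF w_cont[unfolded S_def] w_per])
    show "((\<lambda>\<tau>. w (x, \<tau>)) has_real_derivative (\<Sum>j\<in>UNIV. 2 * P j (x, t) * partial_on S bt (P j) (x, t))) (at t)"
      if "t > 0" for x t
      unfolding w_def by (auto intro!: derivative_eq_intros time[OF CP that] sum.cong)
    show "(\<Sum>j\<in>UNIV. 2 * P j (x, t) * partial_on S bt (P j) (x, t)) \<le> 0"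
      if "t > 0" and max: "\<And>y. w (y, t) \<le> w (x, t)" for x t
    proof -
      interpret diffusion_slice \<psi> R "\<lambda>x. u (x, t)" "\<lambda>i x. P i (x, t)" "\<lambda>i j x. Q i j (x, t)"
        "\<lambda>k i j x. T k i j (x, t)" using slice \<open>t > 0\<close> by simp
      have z: "(x, t) \<in> U" using \<open>t > 0\<close> by (simp add: U_def)
      have "t \<ge> 0" using \<open>t > 0\<close> by simp
      note Wt = W[OF this] and rt = in_R[OF this]
      \<comment> \<open>The equation holds on the whole slice, so the divergence inherits its
        differentiability from u_t, which is of class C^2 because u is of class C^3.\<close>
      have "(divergence flux has_derivative (\<lambda>h. \<Sum>i\<in>UNIV. h $ i * partial_on S (be i) ut (x, t))) (at x)"
        using space[OF Cut \<open>t \<ge> 0\<close>, of x] unfolding u_t[OF \<open>t > 0\<close>] .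
      from divergence_flux_derivative_at_gradient_max[OF _ this symm[OF z]]
      have "(\<Sum>i\<in>UNIV. P i (x, t) * partial_on S (be i) ut (x, t)) \<le> 0"
        using max bspec[OF cond1 rt[of x]] bspec[OF cond2 rt[of x]] conc[OF rt[of x]] by (simp add: Wt)
      \<comment> \<open>Interchanging D_t and D_j turns the sum of the 2 p_j D_t p_j into 2 p . D
        u_t, whose sign has just been found.\<close>
      moreover have "partial_on S bt (P j) (x, t) = partial_on S (be j) ut (x, t)" for j
        unfolding P_def ut_def by (rule partial_on_commute[OF Cu U z bt be])
      ultimately show ?thesis by (simp add: sum_distrib_left[symmetric] mult.assoc)
    qed
    show "w (x, 0) \<le> (sup_norm (grad u0))\<^sup>2" for x
      using sup_upper[of 0 x] w_nonneg[of "(x, 0)"] real_le_rsqrt sqrt_le_D u0 by auto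
  qed (use t in auto)
  have "sup_norm (grad (\<lambda>x. u (x, t))) \<le> sup_norm (grad u0)" if t: "t \<ge> 0" for t
    unfolding sup_norm_def[of "grad (\<lambda>x. u (x, t))"]
  proof (rule cSUP_least)
    fix x
    have "0 \<le> sup_norm (grad u0)"
      using order_trans[OF real_sqrt_ge_zero[OF w_nonneg] sup_upper[of 0 x]] u0 by simp
    then show "norm (grad (\<lambda>x. u (x, t)) x) \<le> sup_norm (grad u0)"
      unfolding grad_w[OF t] using gradient[OF t, of x] by (simp add: real_le_lsqrt)
  qed simp
  then show ?thesis using upper lower by blast
qed

end
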